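(* Let $f=g+h$ on $X$ satisfy the standing assumption (H) described in the context. Let $(x^n)_{n\in\mathbb N}$ be generated by the Forward-Backward algorithm $$x^0\in X,\quad \lambda\in\left]0,2L^{-1}\right[,\quad x^{n+1}=\operatorname{prox}_{\lambda g}\big(x^n-\lambda\nabla h(x^n)\big),$$ and let $\bar x$ be any minimizer of $f$. Then the number of iterations $n\ge1$ for which the support of $x^n$ is not included in $\operatorname{esupp}(\bar x)$ is finite, and cannot exceed $\rho_{\rm sol}^{-2}\lambda^{-2}\|x^0-\bar x\|^2$.
   Context: $X$ is a real separable Hilbert space with inner product $\langle\cdot,\cdot\rangle$ and norm $\|\cdot\|$; $\mathcal N\subset\mathbb N$ and $(e_k)_{k\in\mathcal N}$ is an orthonormal basis of $X$; for $x\in X$, $x_k=\langle x,e_k\rangle$ (in particular $\nabla h(x)_k=\langle\nabla h(x),e_k\rangle$). $\Gamma_0(H)$ denotes the set of proper convex lower semicontinuous functions from a Hilbert space $H$ to $\mathbb R\cup\{+\infty\}$. For an interval $I\subset\mathbb R$, $\sigma_I(t)=\sup_{s\in I}st$ is its support function, $\operatorname{int}I$ its interior and $\operatorname{bd}I$ its boundary. Standing assumption (H): $f=g+h$, where - $h\in\Gamma_0(X)$ is bounded from below and differentiable, and $\nabla h$ is $L$-Lipschitz continuous on $X$, $L\in\left]0,+\infty\right[$; - $g(x)=\sum_{k\in\mathcal N}g_k(x_k)$ with $g_k=\psi_k+\sigma_{I_k}$, where each $I_k$ is a proper closed interval of $\mathbb R$ ($I_k\neq\mathbb R$), there exists $\omega>0$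 such that $[-\omega,\omega]\subset I_k$ for all $k\in\mathcal N$, and each $\psi_k\in\Gamma_0(\mathbb R)$ is differentiable at $0$ with $\psi_k(0)=0$ and $\psi_k'(0)=0$. $\operatorname{prox}_{\lambda g}(x)$ is the unique minimizer of $y\mapsto g(y)+\frac1{2\lambda}\|y-x\|^2$. $\operatorname{supp}(x)=\{k\in\mathcal N:x_k\ne0\}$. The extended support of $x\in X$ is $\operatorname{esupp}(x)=\operatorname{supp}(x)\cup\{k\in\mathcal N:-\nabla h(x)_k\in\operatorname{bd}I_k\}$. For $u\in X$, $\rho(u)=\inf\{\operatorname{dist}(u_k,\operatorname{bd}I_k): k\in\mathcal N,\ u_k\in\operatorname{int}I_k\}$, and $\rho_{\rm sol}=\rho(-\nabla h(\bar x))$ for any $\bar x\in\operatorname{argmin}f$; this does not depend on the choice of $\bar x$, since $\nabla h$ is constant on $\operatorname{argmin}f$. Convention: $\inf\emptyset=+\infty$ and $(+\infty)^{-2}=0$. *)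

theory Defs
  imports "HOL-Analysis.Analysis"
begin

definition proper_fun :: "('a \<Rightarrow> ereal) \<Rightarrow> bool" where
  "proper_fun f \<longleftrightarrow> (\<forall>x. f x \<noteq> - \<infinity>) \<and> (\<exists>x. f x \<noteq> \<infinity>)"

text \<open>Restricting to weights in the open interval avoids the product of 0 and infinity.\<close>

definition convex_fun :: "('a::real_vector \<Rightarrow> ereal) \<Rightarrow> bool" where
  "convex_fun f \<longleftrightarrow>
     (\<forall>x y. \<forall>t\<in>{0<..<1}.
        f ((1 - t) *\<^sub>R x + t *\<^sub>R y) \<le> ereal (1 - t) * f x + ereal t * f y)"

definition lsc_fun :: "('a::topological_space \<Rightarrow> ereal) \<Rightarrow> bool" where
  "lsc_fun f \<longleftrightarrow> (\<forall>x. f x \<le> Liminf (at x) f)"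

definition Gamma0 :: "('a::real_inner \<Rightarrow> ereal) set" where
  "Gamma0 = {f. proper_fun f \<and> convex_fun f \<and> lsc_fun f}"

text \<open>Differentiability of an extended-valued function at a point includes finiteness
  near that point; the finiteness clause is needed because \<^const>\<open>real_of_ereal\<close>
  maps the infinite values to 0.\<close>

definition has_ext_derivative_at :: "(real \<Rightarrow> ereal) \<Rightarrow> real \<Rightarrow> real \<Rightarrow> bool" where
  "has_ext_derivative_at f D a \<longleftrightarrow>
     (\<forall>\<^sub>F t in nhds a. \<bar>f t\<bar> \<noteq> \<infinity>) \<and>
     ((\<lambda>t. real_of_ereal (f t)) has_real_derivative D) (at a)"

definition orthonormal_basis :: "nat set \<Rightarrow> (nat \<Rightarrow> 'a::real_inner) \<Rightarrow> bool" where
  "orthonormal_basis N e \<longleftrightarrow>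
     (\<forall>i\<in>N. \<forall>j\<in>N. e i \<bullet> e j = (if i = j then 1 else 0)) \<and>
     closure (span (e ` N)) = UNIV"

definition support_fun :: "real set \<Rightarrow> real \<Rightarrow> ereal" where
  "support_fun I t = (SUP s\<in>I. ereal (s * t))"

text \<open>The sum is unordered. Under the standing assumptions all terms are nonnegative
  (each \<open>\<psi> k\<close> is minimal at 0 and \<open>0 \<in> I k\<close>), so it always exists in the
  extended reals.\<close>

definition separable_fun ::
    "nat set \<Rightarrow> (nat \<Rightarrow> 'a::real_inner) \<Rightarrow> (nat \<Rightarrow> real \<Rightarrow> ereal) \<Rightarrow> 'a \<Rightarrow> ereal" where
  "separable_fun N e gs x = (\<Sum>\<^sub>\<infinity>k\<in>N. gs k (x \<bullet> e k))"

definition argmin :: "('a \<Rightarrow> ereal) \<Rightarrow> 'a set" where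
  "argmin f = {x. \<forall>y. f x \<le> f y}"

definition prox :: "real \<Rightarrow> ('a::real_inner \<Rightarrow> ereal) \<Rightarrow> 'a \<Rightarrow> 'a" where
  "prox lam g x = (THE p. p \<in> argmin (\<lambda>y. g y + ereal (1 / (2 * lam) * (norm (y - x))\<^sup>2)))"

definition supp :: "nat set \<Rightarrow> (nat \<Rightarrow> 'a::real_inner) \<Rightarrow> 'a \<Rightarrow> nat set" where
  "supp N e x = {k\<in>N. x \<bullet> e k \<noteq> 0}"

text \<open>Here \<open>dh\<close> stands for the gradient of \<open>h\<close>.\<close>

definition esupp ::
    "nat set \<Rightarrow> (nat \<Rightarrow> 'a::real_inner) \<Rightarrow> (nat \<Rightarrow> real set) \<Rightarrow> ('a \<Rightarrow> 'a) \<Rightarrow> 'a \<Rightarrow> nat set" where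
  "esupp N e I dh x = supp N e x \<union> {k\<in>N. (- dh x) \<bullet> e k \<in> frontier (I k)}"

text \<open>Valued in the extended reals, so that the infimum over the empty set is infinite
  (and its inverse is 0).\<close>

definition rho ::
    "nat set \<Rightarrow> (nat \<Rightarrow> 'a::real_inner) \<Rightarrow> (nat \<Rightarrow> real set) \<Rightarrow> 'a \<Rightarrow> ereal" where
  "rho N e I u =
     (INF k\<in>{k\<in>N. u \<bullet> e k \<in> interior (I k)}. ereal (infdist (u \<bullet> e k) (frontier (I k))))"

end

theory Submission
  imports Defs
begin

text \<open>
  Write \<open>w\<close> for minus the gradient of \<open>h\<close> at the minimizer \<open>xbar\<close>. Optimality says that \<open>w\<close>
  is a subgradient of \<open>g\<close> at \<open>xbar\<close>, and one proximal step from \<open>u = x n - lam *\<^sub>R dh (x n)\<close>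
  produces \<open>p = x (Suc n)\<close> together with the subgradient \<open>v = (u - p) / lam\<close> of \<open>g\<close> at
  \<open>p\<close>. Monotonicity of the subdifferential, \<open>(v - w) \<bullet> (p - xbar) \<ge> 0\<close>, makes the
  cross term in the expansion of
  \<open>u - (xbar + lam *\<^sub>R w) = (p - xbar) + lam *\<^sub>R (v - w)\<close>
  nonnegative, so that the squared distance to \<open>xbar\<close> drops by at least
  \<open>(lam * norm (v - w))\<^sup>2\<close> in the proximal step (\<open>resolvent_quantitative_decrease\<close>). The
  gradient step does not increase this distance, because Lipschitz gradients of convex
  functions are cocoercive (\<open>gradient_cocoercive\<close>, \<open>gradient_step_nonexpansive\<close>).

  The rest of the argument bounds \<open>norm (v - w)\<close> from below when the support of \<open>p\<close> leaves
  the extended support of \<open>xbar\<close>. Then some coordinate \<open>k\<close> has a nonzero entry in \<open>p\<close> and a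
  zero entry in \<open>xbar\<close>, and \<open>w\<close> has its \<open>k\<close>-th coordinate in \<open>I k\<close>
  (\<open>minorant_slope_mem\<close>) but off the boundary. A nonzero entry of \<open>p\<close> forces the
  \<open>k\<close>-th coordinate of \<open>v\<close> to lie at or beyond the end of \<open>I k\<close> on the side of that entry, hence
  at a distance at least \<open>rho\<close> from that of \<open>w\<close> (\<open>frontier_distance_le_slope_gap\<close>). So every such
  iteration costs at least \<open>(lam * rho)\<^sup>2\<close> out of the initial budget
  \<open>(norm (x 0 - xbar))\<^sup>2\<close>, which gives the bound
  (\<open>card_le_of_quantitative_decrease\<close>). It is finite because \<open>rho\<close> is positive
  (\<open>rho_pos\<close>): the coordinates of \<open>w\<close> are square summable, so all but finitely many are
  smaller than \<open>\<omega> / 2\<close> in modulus, whereas no boundary point of \<open>I k\<close> is below \<open>\<omega>\<close> in modulus.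

  The definition of \<open>prox\<close> by a definite description has content only if the minimizer exists and
  is unique. Existence comes from strong convexity of the proximal objective, completeness of the
  space, and lower semicontinuity of \<open>g\<close>, which is a supremum of finite sums of nonnegative lower
  semicontinuous functions of single coordinates.
\<close>

section \<open>Convexity and lower semicontinuity of extended-valued functions\<close>

lemma convex_funD:
  assumes "convex_fun f" "0 < t" "t < 1"
  shows "f ((1 - t) *\<^sub>R x + t *\<^sub>R y) \<le> ereal (1 - t) * f x + ereal t * f y"
  using assms by (auto simp: convex_fun_def)

text \<open>Nonnegativity lets the weights distribute over the sums and excludes
  \<open>\<infinity> - \<infinity>\<close>.\<close>

lemma convex_fun_add:
  assumes "convex_fun f" "convex_fun g" "\<And>x. 0 \<le> f x" "\<And>x. 0 \<le> g x"
  shows "convex_fun (\<lambda>x. f x + g x)"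
  unfolding convex_fun_def
proof (intro allI ballI)
  fix x y :: 'a and t :: real
  assume t: "t \<in> {0<..<1}"
  have "f ((1 - t) *\<^sub>R x + t *\<^sub>R y) + g ((1 - t) *\<^sub>R x + t *\<^sub>R y)
      \<le> (ereal (1 - t) * f x + ereal t * f y) + (ereal (1 - t) * g x + ereal t * g y)"
    using t by (intro add_mono convex_funD assms) auto
  also have "\<dots> = ereal (1 - t) * (f x + g x) + ereal t * (f y + g y)"
    using assms(3,4) by (simp add: ereal_right_distrib ac_simps)
  finally show "f ((1 - t) *\<^sub>R x + t *\<^sub>R y) + g ((1 - t) *\<^sub>R x + t *\<^sub>R y) \<le> \<dots>" .
qed

lemma convex_fun_SUP:
  fixes f :: "'i \<Rightarrow> 'a::real_vector \<Rightarrow> ereal"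
  assumes "\<And>i. i \<in> A \<Longrightarrow> convex_fun (f i)"
  shows "convex_fun (\<lambda>x. SUP i\<in>A. f i x)"
  unfolding convex_fun_def
proof (intro allI ballI SUP_least)
  fix x y :: 'a and t :: real and i
  assume t: "t \<in> {0<..<1}" and i: "i \<in> A"
  have "f i ((1 - t) *\<^sub>R x + t *\<^sub>R y) \<le> ereal (1 - t) * f i x + ereal t * f i y"
    using t i by (intro convex_funD assms) auto
  also have "\<dots> \<le> ereal (1 - t) * (SUP i\<in>A. f i x) + ereal t * (SUP i\<in>A. f i y)"
    using t i by (intro add_mono ereal_mult_left_mono SUP_upper) auto
  finally show "f i ((1 - t) *\<^sub>R x + t *\<^sub>R y) \<le> \<dots>" .
qed

lemma convex_fun_inner:
  assumes "convex_fun f"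
  shows "convex_fun (\<lambda>x. f (x \<bullet> v))"
  using assms unfolding convex_fun_def by (simp add: inner_add_left)

text \<open>Open strict superlevel sets make stability under suprema and under composition with
  continuous maps immediate, without handling limits at punctured neighbourhoods.\<close>

lemma lsc_fun_iff_open:
  "lsc_fun f \<longleftrightarrow> (\<forall>c. open {x. c < f x})"
proof
  assume lsc: "lsc_fun f"
  show "\<forall>c. open {x. c < f x}"
  proof
    fix c
    have "\<forall>\<^sub>F y in nhds x. c < f y" if "c < f x" for x
    proof -
      have "c < Liminf (at x) f"
        using lsc that by (auto simp: lsc_fun_def intro: less_le_trans)
      then have "\<forall>\<^sub>F y in at x. c < f y"
        using le_Liminf_iff by blast
      then show ?thesis
        using that by (auto simp: eventually_at_filter elim: eventually_mono)
    qed
    then show "open {x. c < f x}"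
      by (subst open_subopen) (auto simp: eventually_nhds subset_eq)
  qed
next
  assume *: "\<forall>c. open {x. c < f x}"
  show "lsc_fun f"
    unfolding lsc_fun_def le_Liminf_iff
  proof (intro allI impI)
    fix x c assume "c < f x"
    then have "\<forall>\<^sub>F y in nhds x. c < f y"
      using * by (auto simp: eventually_nhds)
    then show "\<forall>\<^sub>F y in at x. c < f y"
      by (auto simp: eventually_at_filter elim: eventually_mono)
  qed
qed

lemma lsc_fun_continuous:
  fixes f :: "'a::topological_space \<Rightarrow> real"
  assumes "continuous_on UNIV f"
  shows "lsc_fun (\<lambda>x. ereal (f x))"
  unfolding lsc_fun_iff_open
  using assms by (intro allI open_Collect_less continuous_intros) auto

lemma lsc_fun_SUP:
  assumes "\<And>i. i \<in> A \<Longrightarrow> lsc_fun (f i)"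
  shows "lsc_fun (\<lambda>x. SUP i\<in>A. f i x)"
proof -
  have "{x. c < (SUP i\<in>A. f i x)} = (\<Union>i\<in>A. {x. c < f i x})" for c
    by (auto simp: less_SUP_iff)
  then show ?thesis
    using assms unfolding lsc_fun_iff_open by (auto intro!: open_UN)
qed

lemma lsc_fun_inner:
  assumes "lsc_fun f"
  shows "lsc_fun (\<lambda>x. f (x \<bullet> v))"
  unfolding lsc_fun_iff_open
proof
  fix c
  have "open ((\<lambda>x. x \<bullet> v) -` {t. c < f t})"
    using assms by (intro open_vimage continuous_intros) (auto simp: lsc_fun_iff_open)
  then show "open {x. c < f (x \<bullet> v)}" by (simp add: vimage_def)
qed

lemma lsc_fun_add:
  assumes "lsc_fun f" "lsc_fun g" "\<And>x. 0 \<le> f x" "\<And>x. 0 \<le> g x"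
  shows "lsc_fun (\<lambda>x. f x + g x)"
  unfolding lsc_fun_def
proof
  fix x
  show "f x + g x \<le> Liminf (at x) (\<lambda>y. f y + g y)"
  proof (cases "at x = bot")
    case False
    have "f x + g x \<le> Liminf (at x) f + Liminf (at x) g"
      using assms(1,2) by (intro add_mono) (auto simp: lsc_fun_def)
    also have "\<dots> \<le> Liminf (at x) (\<lambda>y. f y + g y)"
      using assms(3,4) False by (intro Liminf_add_le) auto
    finally show ?thesis .
  qed (simp add: le_Liminf_iff)
qed

section \<open>Subgradients and the proximity operator\<close>

text \<open>The value at the base point is required to be finite: otherwise every vector would be a
  subgradient at a point of value \<open>-\<infinity>\<close>, and at every point of a function that is constantly \<open>\<infinity>\<close>.\<close>

definition subgradient :: "('a::real_inner \<Rightarrow> ereal) \<Rightarrow> 'a \<Rightarrow> 'a \<Rightarrow> bool" where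
  "subgradient g p v \<longleftrightarrow> \<bar>g p\<bar> \<noteq> \<infinity> \<and> (\<forall>y. g p + ereal (v \<bullet> (y - p)) \<le> g y)"

lemma subgradient_monotone:
  assumes "subgradient g p v" "subgradient g q w"
  shows "0 \<le> (v - w) \<bullet> (p - q)"
proof -
  obtain a b where ab: "g p = ereal a" "g q = ereal b"
    using assms by (auto simp: subgradient_def)
  have "g p + ereal (v \<bullet> (q - p)) \<le> g q" "g q + ereal (w \<bullet> (p - q)) \<le> g p"
    using assms by (auto simp: subgradient_def)
  then show ?thesis
    by (simp add: ab inner_diff_left inner_diff_right)
qed

lemma GDERIV_along_line:
  assumes "GDERIV h (p + t *\<^sub>R d) :> D"
  shows "((\<lambda>s. h (p + s *\<^sub>R d)) has_real_derivative d \<bullet> D) (at t)"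
proof -
  have "((\<lambda>s. p + s *\<^sub>R d) has_derivative (\<lambda>s. s *\<^sub>R d)) (at t)"
    by (auto intro!: derivative_eq_intros)
  then have "((\<lambda>s. h (p + s *\<^sub>R d)) has_derivative (\<lambda>s. (s *\<^sub>R d) \<bullet> D)) (at t)"
    by (rule has_derivative_compose) (use assms in \<open>simp add: gderiv_def\<close>)
  then show ?thesis
    by (rule has_derivative_imp_has_field_derivative) simp
qed

text \<open>First-order optimality for a sum with a smooth term. Along the segment from \<open>p\<close> to \<open>y\<close>,
  convexity bounds the increase of \<open>g\<close> linearly in \<open>t\<close>, so minimality bounds the difference quotient
  of \<open>h\<close> from below by \<open>g p - g y\<close>; the limit \<open>t \<rightarrow> 0\<close> is the subgradient inequality. The
  smooth term may be concave: the gradient inequality of a convex function uses this.\<close>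

lemma minimizer_imp_subgradient:
  assumes conv: "convex_fun g" and fin: "\<bar>g p\<bar> \<noteq> \<infinity>" and nmi: "\<And>y. g y \<noteq> -\<infinity>"
    and grad: "GDERIV h p :> D"
    and min: "\<And>y. g p + ereal (h p) \<le> g y + ereal (h y)"
  shows "subgradient g p (- D)"
  unfolding subgradient_def
proof (intro conjI allI fin)
  fix y
  show "g p + ereal (- D \<bullet> (y - p)) \<le> g y"
  proof (cases "g y = \<infinity>")
    case False
    obtain a b where ab: "g p = ereal a" "g y = ereal b"
      using fin nmi[of y] False by (cases "g p"; cases "g y") auto
    let ?\<phi> = "\<lambda>t. h (p + t *\<^sub>R (y - p))"
    have quot: "a - b \<le> (?\<phi> t - ?\<phi> 0) / t" if t: "0 < t" "t < 1" for t
    proof -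
      let ?z = "(1 - t) *\<^sub>R p + t *\<^sub>R y"
      have z: "?z = p + t *\<^sub>R (y - p)" by (simp add: algebra_simps)
      have "ereal (a + h p) \<le> g ?z + ereal (h ?z)"
        using min[of ?z] ab by simp
      also have "\<dots> \<le> (ereal (1 - t) * g p + ereal t * g y) + ereal (h ?z)"
        by (intro add_mono convex_funD conv t order_refl)
      finally have "t * (a - b) \<le> h ?z - h p"
        by (simp add: ab algebra_simps)
      then show ?thesis
        using t by (simp add: z field_simps)
    qed
    have "((\<lambda>t. (?\<phi> t - ?\<phi> 0) / t) \<longlongrightarrow> (y - p) \<bullet> D) (at 0)"
      using GDERIV_along_line[of h p 0 "y - p" D] grad by (simp add: DERIV_def)
    then have lim: "((\<lambda>t. (?\<phi> t - ?\<phi> 0) / t) \<longlongrightarrow> (y - p) \<bullet> D) (at_right 0)"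
      by (rule filterlim_mono) (auto simp: at_le)
    have "a - b \<le> (y - p) \<bullet> D"
      by (rule tendsto_lowerbound[OF lim])
        (use quot in \<open>auto simp: eventually_at_right[of 0 1] intro!: exI[of _ 1]\<close>)
    then show ?thesis
      by (simp add: ab inner_commute)
  qed simp
qed

text \<open>The midpoint is written with weights \<open>1 - t\<close> and \<open>t\<close> so as to match the definition of
  convexity at \<open>t = 1/2\<close>.\<close>

lemma norm_midpoint_diff_squared:
  fixes x y z :: "'a::real_inner"
  shows "(norm ((1 - 1/2) *\<^sub>R y + (1/2) *\<^sub>R z - x))\<^sup>2
    = (norm (y - x))\<^sup>2 / 2 + (norm (z - x))\<^sup>2 / 2 - (norm (y - z))\<^sup>2 / 4"
  by (simp add: power2_norm_eq_inner inner_diff_left inner_diff_right inner_add_left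
      inner_add_right inner_commute field_simps)

text \<open>The sublevel sets just above the infimum \<open>m\<close> are closed and nested, and strong convexity
  makes their diameters shrink: if two points have values at most \<open>m + \<epsilon>\<close>, the value at their
  midpoint is at most \<open>m + \<epsilon>\<close> minus \<open>c / 4\<close> times their squared distance, while it is at least \<open>m\<close>.
  By completeness they have a common point.\<close>

lemma prox_objective_has_minimizer:
  fixes g :: "'a::{real_inner, complete_space} \<Rightarrow> ereal"
  assumes conv: "convex_fun g" and lsc: "lsc_fun g" and nn: "\<And>y. 0 \<le> g y"
    and fin: "g y0 \<noteq> \<infinity>" and c: "0 < c"
  shows "\<exists>p. p \<in> argmin (\<lambda>y. g y + ereal (c * (norm (y - x))\<^sup>2))"
proof -
  define \<phi> where "\<phi> = (\<lambda>y. g y + ereal (c * (norm (y - x))\<^sup>2))"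
  have nn\<phi>: "0 \<le> \<phi> y" for y
    using nn[of y] c by (auto simp: \<phi>_def)
  have "0 \<le> (INF y. \<phi> y)" by (intro INF_greatest nn\<phi>)
  moreover have "(INF y. \<phi> y) \<noteq> \<infinity>"
    using fin INF_lower[of y0 UNIV \<phi>] by (auto simp: \<phi>_def top_ereal_def)
  ultimately obtain m where m: "(INF y. \<phi> y) = ereal m"
    by (cases "INF y. \<phi> y") auto
  have m_le: "ereal m \<le> \<phi> y" for y
    unfolding m[symmetric] by (rule INF_lower) simp
  define S where "S n = {y. \<phi> y \<le> ereal (m + 1 / Suc n)}" for n
  have "lsc_fun \<phi>"
    unfolding \<phi>_def using c
    by (intro lsc_fun_add lsc lsc_fun_continuous continuous_intros) (auto simp: nn)
  then have "closed (S n)" for n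
    by (auto simp: S_def lsc_fun_iff_open closed_def Collect_neg_eq[symmetric] not_le)
  moreover have "S n \<noteq> {}" for n
  proof -
    have "(INF y. \<phi> y) < ereal (m + 1 / Suc n)" by (simp add: m)
    then show ?thesis
      by (auto simp: INF_less_iff S_def dest: less_imp_le)
  qed
  moreover have "S n \<subseteq> S k" if "k \<le> n" for k n
  proof -
    have "1 / real (Suc n) \<le> 1 / real (Suc k)"
      using that by (simp add: frac_le)
    then show ?thesis
      by (auto simp: S_def elim!: order_trans)
  qed
  moreover have "\<exists>n. \<forall>y\<in>S n. \<forall>z\<in>S n. dist y z < \<epsilon>" if \<epsilon>: "0 < \<epsilon>" for \<epsilon>
  proof -
    obtain n where n: "1 / real (Suc n) < c / 4 * \<epsilon>\<^sup>2"
      using nat_approx_posE[of "c / 4 * \<epsilon>\<^sup>2"] c \<epsilon> by auto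
    have "dist y z < \<epsilon>" if yz: "y \<in> S n" "z \<in> S n" for y z
    proof -
      let ?w = "(1 - 1/2) *\<^sub>R y + (1/2) *\<^sub>R z"
      obtain a b where ab: "g y = ereal a" "g z = ereal b"
        using yz nn[of y] nn[of z] by (cases "g y"; cases "g z") (auto simp: S_def \<phi>_def)
      have "ereal m \<le> g ?w + ereal (c * (norm (?w - x))\<^sup>2)"
        using m_le[of ?w] by (simp add: \<phi>_def)
      also have "\<dots> \<le> (ereal (1 - 1/2) * g y + ereal (1/2) * g z) + ereal (c * (norm (?w - x))\<^sup>2)"
        by (intro add_mono convex_funD conv) auto
      finally have "m \<le> a / 2 + b / 2 + c * (norm (?w - x))\<^sup>2"
        by (simp add: ab)
      moreover have "a + c * (norm (y - x))\<^sup>2 \<le> m + 1 / Suc n"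
          "b + c * (norm (z - x))\<^sup>2 \<le> m + 1 / Suc n"
        using yz by (auto simp: S_def \<phi>_def ab)
      ultimately have "c / 4 * (norm (y - z))\<^sup>2 \<le> 1 / Suc n"
        unfolding norm_midpoint_diff_squared by (simp add: algebra_simps)
      with n have "c / 4 * (norm (y - z))\<^sup>2 < c / 4 * \<epsilon>\<^sup>2"
        by (rule le_less_trans[rotated])
      then have "(norm (y - z))\<^sup>2 < \<epsilon>\<^sup>2"
        using c by simp
      then show ?thesis
        using \<epsilon> by (simp add: dist_norm power2_less_imp_less)
    qed
    then show ?thesis by blast
  qed
  ultimately obtain p where p: "\<And>n. p \<in> S n"
    using decreasing_closed_nest[of S] by blast
  have "\<phi> p \<le> ereal m"
  proof (rule ereal_le_epsilon2)
    fix \<epsilon> :: real assume "0 < \<epsilon>"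
    then obtain n where "1 / real (Suc n) < \<epsilon>"
      using nat_approx_posE by blast
    then show "\<phi> p \<le> ereal m + ereal \<epsilon>"
      using p[of n] by (auto simp: S_def elim!: order_trans)
  qed
  then show ?thesis
    using m_le by (auto simp: argmin_def \<phi>_def intro: order_trans)
qed

lemma GDERIV_norm_squared:
  "GDERIV (\<lambda>y. c * (norm (y - u))\<^sup>2) p :> (2 * c) *\<^sub>R (p - u)"
  unfolding gderiv_def power2_norm_eq_inner
  by (auto intro!: derivative_eq_intros simp: algebra_simps inner_commute)

text \<open>Every minimizer of the proximal objective satisfies the subgradient inclusion, and its
  monotonicity forces two minimizers to coincide; so the definite description denotes the minimizer,
  which inherits the inclusion.\<close>

lemma prox_subgradient:
  fixes g :: "'a::{real_inner, complete_space} \<Rightarrow> ereal"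
  assumes conv: "convex_fun g" and lsc: "lsc_fun g" and nn: "\<And>y. 0 \<le> g y"
    and fin: "g y0 \<noteq> \<infinity>" and lam: "0 < lam"
  shows "subgradient g (prox lam g u) ((1 / lam) *\<^sub>R (u - prox lam g u))"
proof -
  let ?\<phi> = "\<lambda>y. g y + ereal (1 / (2 * lam) * (norm (y - u))\<^sup>2)"
  have sub: "subgradient g p ((1 / lam) *\<^sub>R (u - p))" if p: "p \<in> argmin ?\<phi>" for p
  proof -
    have "?\<phi> p \<le> ?\<phi> y0" using p by (simp add: argmin_def)
    then have "\<bar>g p\<bar> \<noteq> \<infinity>" using fin nn[of p] by auto
    then have "subgradient g p (- ((2 * (1 / (2 * lam))) *\<^sub>R (p - u)))"
      using p nn
      by (intro minimizer_imp_subgradient[OF conv _ _ GDERIV_norm_squared])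
        (auto simp: argmin_def)
    moreover have "- ((2 * (1 / (2 * lam))) *\<^sub>R (p - u)) = (1 / lam) *\<^sub>R (u - p)"
      by (simp add: algebra_simps)
    ultimately show ?thesis by simp
  qed
  have uniq: "p = q" if "p \<in> argmin ?\<phi>" "q \<in> argmin ?\<phi>" for p q
  proof -
    have "0 \<le> ((1 / lam) *\<^sub>R (u - p) - (1 / lam) *\<^sub>R (u - q)) \<bullet> (p - q)"
      using that by (intro subgradient_monotone[of g] sub)
    also have "(1 / lam) *\<^sub>R (u - p) - (1 / lam) *\<^sub>R (u - q) = - ((1 / lam) *\<^sub>R (p - q))"
      by (simp add: algebra_simps)
    finally have "(p - q) \<bullet> (p - q) \<le> 0"
      using lam by (simp add: zero_le_divide_iff divide_le_0_iff)
    then show ?thesis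
      by (metis eq_iff_diff_eq_0 inner_gt_zero_iff not_le)
  qed
  obtain p where p: "p \<in> argmin ?\<phi>"
    using prox_objective_has_minimizer[OF conv lsc nn fin, of "1 / (2 * lam)" u] lam by auto
  then have "prox lam g u = p"
    unfolding prox_def using uniq by (intro the_equality) auto
  then show ?thesis using sub[OF p] by simp
qed

section \<open>Cocoercivity of a Lipschitz gradient\<close>

text \<open>The sum of \<open>h\<close> and \<open>-h\<close> is constant, so every point minimizes it, and first-order optimality
  with smooth part \<open>-h\<close> turns the gradient of \<open>h\<close> into a subgradient.\<close>

lemma convex_gradient_inequality:
  fixes h :: "'a::real_inner \<Rightarrow> real"
  assumes conv: "convex_fun (\<lambda>y. ereal (h y))" and grad: "GDERIV h x :> D"
  shows "h x + D \<bullet> (y - x) \<le> h y"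
proof -
  have "subgradient (\<lambda>y. ereal (h y)) x (- (- D))"
    by (rule minimizer_imp_subgradient[OF conv _ _ GDERIV_minus[OF grad]]) auto
  then show ?thesis by (simp add: subgradient_def)
qed

text \<open>Along the segment, \<open>h\<close> minus its quadratic upper model has derivative at most 0 by
  Cauchy-Schwarz and the Lipschitz bound, hence does not exceed its value at \<open>x\<close>.\<close>

lemma descent_inequality:
  fixes h :: "'a::real_inner \<Rightarrow> real"
  assumes grad: "\<And>y. GDERIV h y :> dh y" and lip: "L-lipschitz_on UNIV dh"
  shows "h y \<le> h x + dh x \<bullet> (y - x) + L / 2 * (norm (y - x))\<^sup>2"
proof -
  define d where "d = y - x"
  let ?\<phi> = "\<lambda>t. h (x + t *\<^sub>R d) - (t * (d \<bullet> dh x) + L / 2 * (norm d)\<^sup>2 * t\<^sup>2)"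
  have "?\<phi> 1 \<le> ?\<phi> 0"
  proof (rule DERIV_nonpos_imp_nonincreasing[of 0 1 ?\<phi>])
    fix t :: real assume t: "0 \<le> t"
    have "(?\<phi> has_real_derivative
        d \<bullet> dh (x + t *\<^sub>R d) - (d \<bullet> dh x + L * (norm d)\<^sup>2 * t)) (at t)"
      by (rule DERIV_diff[OF GDERIV_along_line[OF grad]]) (auto intro!: derivative_eq_intros)
    moreover have "d \<bullet> dh (x + t *\<^sub>R d) - (d \<bullet> dh x + L * (norm d)\<^sup>2 * t) \<le> 0"
    proof -
      have "d \<bullet> (dh (x + t *\<^sub>R d) - dh x) \<le> norm d * norm (dh (x + t *\<^sub>R d) - dh x)"
        by (rule norm_cauchy_schwarz)
      also have "\<dots> \<le> norm d * (L * (t * norm d))"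
        using lipschitz_onD[OF lip, of "x + t *\<^sub>R d" x] t
        by (intro mult_left_mono) (auto simp: dist_norm)
      finally show ?thesis by (simp add: inner_diff_right power2_eq_square algebra_simps)
    qed
    ultimately show "\<exists>y. DERIV ?\<phi> t :> y \<and> y \<le> 0" by blast
  qed simp
  then show ?thesis by (simp add: d_def inner_commute)
qed

text \<open>The Baillon-Haddad inequality. Compare the linear lower model of \<open>h\<close> at \<open>x\<close> with the quadratic
  upper model at \<open>y\<close>, evaluated at the point \<open>z\<close> that minimizes the difference of the two models;
  adding the resulting inequality to the one with \<open>x\<close> and \<open>y\<close> exchanged gives the claim.\<close>

lemma gradient_cocoercive:
  fixes h :: "'a::real_inner \<Rightarrow> real"
  assumes conv: "convex_fun (\<lambda>y. ereal (h y))" and grad: "\<And>y. GDERIV h y :> dh y"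
    and L: "0 < L" and lip: "L-lipschitz_on UNIV dh"
  shows "(norm (dh x - dh y))\<^sup>2 \<le> L * ((dh x - dh y) \<bullet> (x - y))"
proof -
  have *: "h x + dh x \<bullet> (y - x) + (norm (dh x - dh y))\<^sup>2 / (2 * L) \<le> h y" for x y
  proof -
    define r where "r = dh x - dh y"
    \<comment> \<open>the minimizer over all \<open>z\<close> of the upper model at \<open>y\<close> minus the lower model at \<open>x\<close>\<close>
    define z where "z = y + (1 / L) *\<^sub>R r"
    have zy: "z - y = (1 / L) *\<^sub>R r" and zx: "z - x = (y - x) + (1 / L) *\<^sub>R r"
      by (auto simp: z_def)
    have "h x + dh x \<bullet> (z - x) \<le> h z"
      by (rule convex_gradient_inequality[OF conv grad])
    also have "\<dots> \<le> h y + dh y \<bullet> (z - y) + L / 2 * (norm (z - y))\<^sup>2"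
      by (rule descent_inequality[OF grad lip])
    finally have "h x + dh x \<bullet> (y - x) + (r \<bullet> r) / L \<le> h y + L / 2 * (norm (z - y))\<^sup>2"
      by (simp add: zx zy r_def inner_add_right inner_diff_left inner_diff_right
          add_divide_distrib diff_divide_distrib)
    also have "L / 2 * (norm (z - y))\<^sup>2 = (r \<bullet> r) / (2 * L)"
      using L by (simp add: zy power_mult_distrib power_divide power2_norm_eq_inner[symmetric]
          power2_eq_square[of L])
    finally show ?thesis
      by (simp add: r_def power2_norm_eq_inner field_simps)
  qed
  have "(norm (dh x - dh y))\<^sup>2 / L \<le> (dh x - dh y) \<bullet> (x - y)"
    using *[of x y] *[of y x]
    by (simp add: norm_minus_commute inner_diff_left inner_diff_right)
  then show ?thesis using L by (simp add: field_simps)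
qed

lemma gradient_step_nonexpansive:
  fixes h :: "'a::real_inner \<Rightarrow> real"
  assumes conv: "convex_fun (\<lambda>y. ereal (h y))" and grad: "\<And>y. GDERIV h y :> dh y"
    and L: "0 < L" and lip: "L-lipschitz_on UNIV dh" and lam: "0 < lam" "lam < 2 / L"
  shows "norm ((x - lam *\<^sub>R dh x) - (y - lam *\<^sub>R dh y)) \<le> norm (x - y)"
proof -
  define r where "r = dh x - dh y"
  have "lam * (norm r)\<^sup>2 \<le> 2 / L * (norm r)\<^sup>2"
    using lam by (intro mult_right_mono) auto
  also have "\<dots> \<le> 2 / L * (L * (r \<bullet> (x - y)))"
    using L gradient_cocoercive[OF conv grad L lip, of x y]
    by (intro mult_left_mono) (auto simp: r_def)
  finally have "lam * (norm r)\<^sup>2 \<le> 2 * (r \<bullet> (x - y))" using L by simp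
  then have "lam * (lam * (norm r)\<^sup>2) \<le> lam * (2 * (r \<bullet> (x - y)))"
    using lam by (intro mult_left_mono) auto
  moreover have "(norm ((x - y) - lam *\<^sub>R r))\<^sup>2
      = (norm (x - y))\<^sup>2 - lam * (2 * (r \<bullet> (x - y))) + lam * (lam * (norm r)\<^sup>2)"
    unfolding power2_norm_eq_inner
    by (simp add: inner_diff_left inner_diff_right inner_commute algebra_simps)
  ultimately have "(norm ((x - y) - lam *\<^sub>R r))\<^sup>2 \<le> (norm (x - y))\<^sup>2" by linarith
  moreover have "(x - lam *\<^sub>R dh x) - (y - lam *\<^sub>R dh y) = (x - y) - lam *\<^sub>R r"
    by (simp add: r_def algebra_simps)
  ultimately show ?thesis by (metis norm_ge_zero power2_le_imp_le)
qed

section \<open>One-dimensional penalties and their support functions\<close>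

lemma support_fun_upper:
  "s \<in> I \<Longrightarrow> ereal (s * t) \<le> support_fun I t"
  unfolding support_fun_def by (rule SUP_upper)

lemma support_fun_nonneg:
  "0 \<in> I \<Longrightarrow> 0 \<le> support_fun I t"
  using support_fun_upper[of 0 I t] by (simp add: zero_ereal_def)

lemma support_fun_zero:
  "I \<noteq> {} \<Longrightarrow> support_fun I 0 = 0"
  by (simp add: support_fun_def)

lemma convex_fun_support_fun: "convex_fun (support_fun I)"
proof -
  have "convex_fun (\<lambda>t. ereal (s * t))" for s
    by (simp add: convex_fun_def algebra_simps)
  then have "convex_fun (\<lambda>t. SUP s\<in>I. ereal (s * t))"
    by (intro convex_fun_SUP)
  then show ?thesis by (simp add: support_fun_def[abs_def])
qed

lemma lsc_fun_support_fun: "lsc_fun (support_fun I)"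
proof -
  have "lsc_fun (\<lambda>t. SUP s\<in>I. ereal (s * t))"
    by (intro lsc_fun_SUP lsc_fun_continuous continuous_intros)
  then show ?thesis by (simp add: support_fun_def[abs_def])
qed

text \<open>A zero derivative at a zero means that the function is dominated by \<open>\<epsilon> * \<bar>t\<bar>\<close> near 0. In
  this form it can be compared directly with inequalities between extended reals.\<close>

lemma has_ext_derivative_zero_bound:
  assumes der: "has_ext_derivative_at \<psi> 0 0" and zero: "\<psi> 0 = 0" and \<epsilon>: "0 < \<epsilon>"
  obtains \<delta> where "0 < \<delta>" "\<And>t. \<bar>t\<bar> < \<delta> \<Longrightarrow> \<exists>r. \<psi> t = ereal r \<and> \<bar>r\<bar> \<le> \<epsilon> * \<bar>t\<bar>"
proof -
  let ?r = "\<lambda>t. real_of_ereal (\<psi> t)"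
  have "((\<lambda>t. ?r t / t) \<longlongrightarrow> 0) (at 0)"
    using der zero by (simp add: has_ext_derivative_at_def DERIV_def)
  then have "\<forall>\<^sub>F t in at 0. \<bar>?r t / t\<bar> < \<epsilon>"
    using \<epsilon> by (auto dest: tendstoD simp: dist_real_def)
  then have "\<forall>\<^sub>F t in nhds 0. t \<noteq> 0 \<longrightarrow> \<bar>?r t / t\<bar> < \<epsilon>"
    by (simp add: eventually_at_filter)
  moreover have "\<forall>\<^sub>F t in nhds 0. \<bar>\<psi> t\<bar> \<noteq> \<infinity>"
    using der by (simp add: has_ext_derivative_at_def)
  ultimately have "\<forall>\<^sub>F t in nhds 0. \<exists>r. \<psi> t = ereal r \<and> \<bar>r\<bar> \<le> \<epsilon> * \<bar>t\<bar>"
  proof eventually_elim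
    case (elim t)
    then show ?case
    proof (cases "t = 0")
      case False
      then have "\<bar>?r t\<bar> \<le> \<epsilon> * \<bar>t\<bar>"
        using elim by (simp add: field_simps)
      then show ?thesis
        using elim by (intro exI[of _ "?r t"]) (simp add: ereal_real')
    qed (simp add: zero zero_ereal_def)
  qed
  then show thesis
    using that by (auto simp: eventually_nhds_metric dist_real_def)
qed

text \<open>If \<open>\<psi> y = b < 0\<close>, convexity gives \<open>\<psi> (t * y) \<le> t * b\<close>, a linear decrease at 0 that
  contradicts the zero derivative. The constant \<open>\<epsilon>\<close> is half the slope of this decrease.\<close>

lemma convex_fun_flat_at_zero_nonneg:
  assumes conv: "convex_fun \<psi>" and nmi: "\<And>t. \<psi> t \<noteq> -\<infinity>"
    and der: "has_ext_derivative_at \<psi> 0 0" and zero: "\<psi> 0 = 0"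
  shows "0 \<le> \<psi> y"
proof (rule ccontr)
  assume "\<not> 0 \<le> \<psi> y"
  then obtain b where b: "\<psi> y = ereal b" "b < 0"
    using nmi[of y] by (cases "\<psi> y") auto
  then have "y \<noteq> 0" using zero by auto
  define \<epsilon> where "\<epsilon> = - b / (2 * \<bar>y\<bar>)"
  have "0 < \<epsilon>" using b \<open>y \<noteq> 0\<close> by (simp add: \<epsilon>_def divide_neg_pos)
  then obtain \<delta> where \<delta>: "0 < \<delta>"
      "\<And>t. \<bar>t\<bar> < \<delta> \<Longrightarrow> \<exists>r. \<psi> t = ereal r \<and> \<bar>r\<bar> \<le> \<epsilon> * \<bar>t\<bar>"
    using has_ext_derivative_zero_bound[OF der zero] by blast
  \<comment> \<open>a legitimate convexity weight with \<open>t * y\<close> within \<open>\<delta>\<close> of 0\<close>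
  define t where "t = min (1/2) (\<delta> / (2 * \<bar>y\<bar>))"
  have t: "0 < t" "t < 1" using \<delta>(1) \<open>y \<noteq> 0\<close> by (auto simp: t_def)
  have "t * \<bar>y\<bar> \<le> \<delta> / (2 * \<bar>y\<bar>) * \<bar>y\<bar>"
    by (intro mult_right_mono) (auto simp: t_def)
  then have "\<bar>t * y\<bar> < \<delta>"
    using \<delta>(1) t \<open>y \<noteq> 0\<close> by (simp add: abs_mult)
  then obtain r where r: "\<psi> (t * y) = ereal r" "\<bar>r\<bar> \<le> \<epsilon> * \<bar>t * y\<bar>"
    using \<delta>(2) by blast
  have "\<psi> (t * y) \<le> ereal (t * b)"
    using convex_funD[OF conv t, of 0 y] by (simp add: zero b)
  then have "r \<le> t * b" using r by simp
  moreover have "\<epsilon> * \<bar>t * y\<bar> = - (t * b) / 2"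
    using t \<open>y \<noteq> 0\<close> by (simp add: \<epsilon>_def abs_mult)
  moreover have "t * b < 0" using t b by (simp add: mult_pos_neg)
  ultimately show False using r by linarith
qed

text \<open>If \<open>w\<close> were outside the closed interval, at distance at least \<open>d\<close>, then on
  the side of the sign of \<open>w\<close> the support function would grow with a slope at most
  \<open>\<bar>w\<bar> - d\<close>, and \<open>\<psi>\<close> would have to supply the missing slope \<open>d\<close>, against its zero derivative. So
  the subdifferential of \<open>\<psi> + support_fun I\<close> at 0 is contained in \<open>I\<close>.\<close>

lemma minorant_slope_mem:
  fixes I :: "real set"
  assumes int: "is_interval I" and cl: "closed I" and zeroI: "0 \<in> I"
    and der: "has_ext_derivative_at \<psi> 0 0" and zero: "\<psi> 0 = 0"
    and minorant: "\<And>t. ereal (w * t) \<le> \<psi> t + support_fun I t"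
  shows "w \<in> I"
proof (rule ccontr)
  assume w: "w \<notin> I"
  then obtain d where d: "0 < d" "ball w d \<subseteq> - I"
    using cl by (metis ComplI open_Compl open_contains_ball)
  have gap: "s * sgn w \<le> \<bar>w\<bar> - d" if s: "s \<in> I" for s
  proof -
    have "d \<le> \<bar>s - w\<bar>"
      using d s by (force simp: dist_real_def)
    moreover have "\<not> (0 \<le> w \<and> w \<le> s)" "\<not> (s \<le> w \<and> w \<le> 0)"
      using int zeroI s w unfolding is_interval_1 by blast+
    ultimately show ?thesis
      by (auto simp: sgn_if abs_if split: if_splits)
  qed
  have "w \<noteq> 0" using w zeroI by auto
  obtain \<delta> where \<delta>: "0 < \<delta>"
      "\<And>t. \<bar>t\<bar> < \<delta> \<Longrightarrow> \<exists>r. \<psi> t = ereal r \<and> \<bar>r\<bar> \<le> d / 2 * \<bar>t\<bar>"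
    using has_ext_derivative_zero_bound[OF der zero, of "d / 2"] d by auto
  define \<tau> where "\<tau> = \<delta> / 2"
  have \<tau>: "0 < \<tau>" "\<tau> < \<delta>" using \<delta> by (auto simp: \<tau>_def)
  define t where "t = sgn w * \<tau>"
  have abs_t: "\<bar>t\<bar> = \<tau>" using \<open>w \<noteq> 0\<close> \<tau> by (simp add: t_def abs_mult abs_sgn_eq)
  then obtain r where r: "\<psi> t = ereal r" "\<bar>r\<bar> \<le> d / 2 * \<tau>"
    using \<delta>(2)[of t] \<tau> by auto
  have "support_fun I t \<le> ereal ((\<bar>w\<bar> - d) * \<tau>)"
    unfolding support_fun_def
  proof (rule SUP_least)
    fix s assume "s \<in> I"
    then have "s * sgn w * \<tau> \<le> (\<bar>w\<bar> - d) * \<tau>"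
      using \<tau> by (intro mult_right_mono gap) auto
    then show "ereal (s * t) \<le> ereal ((\<bar>w\<bar> - d) * \<tau>)"
      by (simp add: t_def mult.assoc)
  qed
  then have "\<psi> t + support_fun I t \<le> \<psi> t + ereal ((\<bar>w\<bar> - d) * \<tau>)"
    by (rule add_left_mono)
  with minorant[of t] have "ereal (w * t) \<le> \<psi> t + ereal ((\<bar>w\<bar> - d) * \<tau>)"
    by (rule order_trans)
  moreover have "w * t = \<bar>w\<bar> * \<tau>" by (simp add: t_def abs_sgn)
  ultimately have "\<bar>w\<bar> * \<tau> \<le> r + (\<bar>w\<bar> - d) * \<tau>"
    by (simp add: r)
  then have "d * \<tau> \<le> r" by (simp add: algebra_simps)
  moreover have "0 < d * \<tau>" using d \<tau> by simp
  ultimately show False using r by linarith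
qed

text \<open>Any \<open>d\<close> below the distance to the boundary leaves the closed \<open>d\<close>-ball around \<open>w\<close> inside \<open>I\<close>,
  by connectedness. Testing the support function with the point of this ball furthest in the direction of
  \<open>t\<close> shows that \<open>v\<close> exceeds \<open>w\<close> by at least \<open>d\<close> in that direction.\<close>

lemma frontier_distance_le_slope_gap:
  fixes I :: "real set"
  assumes w: "w \<in> I" and t: "t \<noteq> 0" and le: "support_fun I t \<le> ereal (v * t)"
  shows "infdist w (frontier I) \<le> \<bar>v - w\<bar>"
proof (rule ccontr)
  assume "\<not> ?thesis"
  then obtain d where d: "\<bar>v - w\<bar> < d" "d < infdist w (frontier I)"
    using dense not_le by blast
  define s where "s = w + sgn t * d"
  have "s \<in> I"
  proof (rule ccontr)
    assume "s \<notin> I"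
    moreover have "s \<in> cball w d"
      using d t by (auto simp: s_def dist_real_def abs_mult abs_sgn_eq)
    moreover have "w \<in> cball w d" using d by auto
    ultimately have "cball w d \<inter> I \<noteq> {}" "cball w d - I \<noteq> {}"
      using w by blast+
    then have "cball w d \<inter> frontier I \<noteq> {}"
      by (intro connected_Int_frontier convex_connected convex_cball)
    then obtain z where "z \<in> cball w d" "z \<in> frontier I" by blast
    then have "infdist w (frontier I) \<le> d"
      by (meson infdist_le mem_cball order_trans)
    then show False using d by simp
  qed
  then have "s * t \<le> v * t"
    using support_fun_upper[of s I t] le by (metis ereal_less_eq(3) order_trans)
  then have "d * \<bar>t\<bar> \<le> (v - w) * t"
    by (simp add: s_def abs_sgn algebra_simps)
  also have "\<dots> \<le> \<bar>v - w\<bar> * \<bar>t\<bar>"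
    by (metis abs_ge_self abs_mult)
  finally show False using d t by (simp add: mult_le_cancel_right)
qed

section \<open>Separable functions in orthonormal coordinates\<close>

lemma sum_convex_lsc_nonneg:
  fixes f :: "'i \<Rightarrow> 'a::real_normed_vector \<Rightarrow> ereal"
  assumes "finite F"
    and "\<And>i. i \<in> F \<Longrightarrow> convex_fun (f i)" "\<And>i. i \<in> F \<Longrightarrow> lsc_fun (f i)"
      "\<And>i x. i \<in> F \<Longrightarrow> 0 \<le> f i x"
  shows "convex_fun (\<lambda>x. \<Sum>i\<in>F. f i x) \<and> lsc_fun (\<lambda>x. \<Sum>i\<in>F. f i x)"
  using assms
proof (induction F rule: finite_induct)
  case empty
  have "lsc_fun (\<lambda>x. ereal 0)" by (intro lsc_fun_continuous continuous_intros)
  then show ?case by (simp add: convex_fun_def zero_ereal_def)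
next
  case (insert i F)
  then show ?case
    by (simp add: convex_fun_add lsc_fun_add sum_nonneg)
qed

context
  fixes N :: "nat set" and e :: "nat \<Rightarrow> 'a::real_inner" and gs :: "nat \<Rightarrow> real \<Rightarrow> ereal"
  assumes gs_nonneg: "\<And>k t. k \<in> N \<Longrightarrow> 0 \<le> gs k t"
begin

text \<open>Addition of extended reals is not continuous, so unordered sums cannot be split by passing
  to limits. The properties of the separable function are derived from this supremum instead.\<close>

lemma separable_fun_eq_SUP:
  "separable_fun N e gs x = (SUP F\<in>{F. finite F \<and> F \<subseteq> N}. \<Sum>k\<in>F. gs k (x \<bullet> e k))"
  unfolding separable_fun_def by (rule nonneg_infsum_complete) (rule gs_nonneg)

lemma separable_fun_nonneg: "0 \<le> separable_fun N e gs x"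
  unfolding separable_fun_eq_SUP by (rule SUP_upper2[of "{}"]) auto

lemma separable_fun_zero:
  assumes "\<And>k. k \<in> N \<Longrightarrow> gs k 0 = 0"
  shows "separable_fun N e gs 0 = 0"
  unfolding separable_fun_def using assms by (simp add: infsum_0)

lemma separable_fun_convex_lsc:
  assumes "\<And>k. k \<in> N \<Longrightarrow> convex_fun (gs k)" "\<And>k. k \<in> N \<Longrightarrow> lsc_fun (gs k)"
  shows "convex_fun (separable_fun N e gs)" "lsc_fun (separable_fun N e gs)"
proof -
  have *: "convex_fun (\<lambda>x. \<Sum>k\<in>F. gs k (x \<bullet> e k)) \<and> lsc_fun (\<lambda>x. \<Sum>k\<in>F. gs k (x \<bullet> e k))"
    if "finite F" "F \<subseteq> N" for F
    using that assms gs_nonneg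
    by (intro sum_convex_lsc_nonneg convex_fun_inner lsc_fun_inner) auto
  have eq: "separable_fun N e gs
      = (\<lambda>x. SUP F\<in>{F. finite F \<and> F \<subseteq> N}. \<Sum>k\<in>F. gs k (x \<bullet> e k))"
    by (rule ext) (rule separable_fun_eq_SUP)
  show "convex_fun (separable_fun N e gs)" "lsc_fun (separable_fun N e gs)"
    unfolding eq using * by (auto intro!: convex_fun_SUP lsc_fun_SUP)
qed

text \<open>Replacing one coordinate by one of zero cost removes exactly the cost of that
  coordinate. This holds for the finite partial sums and passes to their supremum.\<close>

lemma separable_fun_split_coordinate:
  assumes k: "k \<in> N" and agree: "\<And>j. j \<in> N - {k} \<Longrightarrow> q \<bullet> e j = p \<bullet> e j"
    and zero: "gs k (q \<bullet> e k) = 0"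
  shows "separable_fun N e gs q + gs k (p \<bullet> e k) = separable_fun N e gs p"
proof -
  let ?FN = "{F. finite F \<and> F \<subseteq> N}"
  let ?s = "\<lambda>x F. \<Sum>j\<in>F. gs j (x \<bullet> e j)"
  let ?c = "gs k (p \<bullet> e k)"
  have eq: "?s q F + ?c = ?s p (insert k F)" if F: "F \<in> ?FN" for F
  proof -
    have "?s q F = ?s q (F - {k})"
      using F zero by (cases "k \<in> F") (auto simp: sum.remove)
    also have "\<dots> = ?s p (F - {k})"
      using F agree by (intro sum.cong) auto
    finally show ?thesis
      using F by (simp add: sum.insert_remove add.commute)
  qed
  have "?c \<noteq> -\<infinity>" using gs_nonneg[OF k, of "p \<bullet> e k"] by auto
  then have "(SUP F\<in>?FN. ?s q F) + ?c = (SUP F\<in>?FN. ?s q F + ?c)"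
    by (intro SUP_ereal_add_left[symmetric]) auto
  also have "\<dots> = (SUP F\<in>?FN. ?s p F)"
  proof (rule antisym)
    show "(SUP F\<in>?FN. ?s q F + ?c) \<le> (SUP F\<in>?FN. ?s p F)"
    proof (rule SUP_least)
      fix F assume "F \<in> ?FN"
      then show "?s q F + ?c \<le> (SUP F\<in>?FN. ?s p F)"
        using k unfolding eq[OF \<open>F \<in> ?FN\<close>] by (intro SUP_upper) auto
    qed
    show "(SUP F\<in>?FN. ?s p F) \<le> (SUP F\<in>?FN. ?s q F + ?c)"
    proof (rule SUP_least)
      fix F assume F: "F \<in> ?FN"
      then have "?s p F \<le> ?s p (insert k F)"
        using k gs_nonneg by (intro sum_mono2) auto
      also have "\<dots> \<le> (SUP F\<in>?FN. ?s q F + ?c)"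
        unfolding eq[OF F, symmetric] using F by (rule SUP_upper)
      finally show "?s p F \<le> \<dots>" .
    qed
  qed
  finally show ?thesis
    unfolding separable_fun_eq_SUP .
qed

text \<open>Both facts come from testing the subgradient inequality in a single coordinate: the first
  by setting the \<open>k\<close>-th coordinate of \<open>p\<close> to 0, the second by moving it from 0 to \<open>t\<close>.\<close>

lemma separable_subgradient_coordinate:
  assumes ortho: "\<And>i j. i \<in> N \<Longrightarrow> j \<in> N \<Longrightarrow> e i \<bullet> e j = (if i = j then 1 else 0)"
    and sub: "subgradient (separable_fun N e gs) p v"
    and k: "k \<in> N" and zero: "gs k 0 = 0"
  shows "gs k (p \<bullet> e k) \<le> ereal ((v \<bullet> e k) * (p \<bullet> e k))"
    and "p \<bullet> e k = 0 \<Longrightarrow> ereal ((v \<bullet> e k) * t) \<le> gs k t"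
proof -
  let ?g = "separable_fun N e gs"
  obtain a where a: "?g p = ereal a" using sub by (auto simp: subgradient_def)
  have ineq: "?g p + ereal (v \<bullet> (y - p)) \<le> ?g y" for y
    using sub by (simp add: subgradient_def)
  let ?y = "p - (p \<bullet> e k) *\<^sub>R e k"
  have "?g ?y + gs k (p \<bullet> e k) = ?g p"
    using k ortho zero by (intro separable_fun_split_coordinate) (auto simp: inner_diff_left)
  then show "gs k (p \<bullet> e k) \<le> ereal ((v \<bullet> e k) * (p \<bullet> e k))"
    using ineq[of ?y] a separable_fun_nonneg[of ?y] gs_nonneg[OF k, of "p \<bullet> e k"]
    by (cases "?g ?y"; cases "gs k (p \<bullet> e k)") (auto simp: mult.commute)
  assume pk: "p \<bullet> e k = 0"
  let ?z = "p + t *\<^sub>R e k"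
  have zk: "?z \<bullet> e k = t" using k ortho pk by (simp add: inner_add_left)
  have "?g p + gs k (?z \<bullet> e k) = ?g ?z"
    using k ortho zero pk by (intro separable_fun_split_coordinate) (auto simp: inner_add_left)
  then show "ereal ((v \<bullet> e k) * t) \<le> gs k t"
    using ineq[of ?z] a unfolding zk
    by (cases "gs k t") (auto simp: mult.commute dest: sym)
qed

end

text \<open>The partial expansion \<open>s\<close> satisfies \<open>s \<bullet> s = u \<bullet> s\<close>, and the claim is \<open>0 \<le> (u - s) \<bullet> (u - s)\<close>.\<close>

lemma Bessel_inequality:
  fixes e :: "'i \<Rightarrow> 'a::real_inner"
  assumes ortho: "\<And>i j. i \<in> F \<Longrightarrow> j \<in> F \<Longrightarrow> e i \<bullet> e j = (if i = j then 1 else 0)"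
    and F: "finite F"
  shows "(\<Sum>k\<in>F. (u \<bullet> e k)\<^sup>2) \<le> (norm u)\<^sup>2"
proof -
  define s where "s = (\<Sum>k\<in>F. (u \<bullet> e k) *\<^sub>R e k)"
  have us: "u \<bullet> s = (\<Sum>k\<in>F. (u \<bullet> e k)\<^sup>2)"
    by (simp add: s_def inner_sum_right power2_eq_square)
  have "s \<bullet> e k = u \<bullet> e k" if "k \<in> F" for k
  proof -
    have "s \<bullet> e k = (\<Sum>j\<in>F. if j = k then u \<bullet> e k else 0)"
      unfolding s_def inner_sum_left using that ortho by (intro sum.cong) auto
    then show ?thesis using F that by simp
  qed
  moreover have "s \<bullet> s = (\<Sum>k\<in>F. (u \<bullet> e k) * (s \<bullet> e k))"
    by (subst (2) s_def) (simp add: inner_sum_right)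
  ultimately have ss: "s \<bullet> s = u \<bullet> s"
    by (simp add: us power2_eq_square)
  have "0 \<le> (u - s) \<bullet> (u - s)" by simp
  then have "u \<bullet> s \<le> u \<bullet> u"
    using ss by (simp add: inner_diff_left inner_diff_right inner_commute)
  then show ?thesis by (simp add: us power2_norm_eq_inner)
qed

lemma finite_large_coordinates:
  fixes e :: "'i \<Rightarrow> 'a::real_inner"
  assumes ortho: "\<And>i j. i \<in> N \<Longrightarrow> j \<in> N \<Longrightarrow> e i \<bullet> e j = (if i = j then 1 else 0)"
    and \<epsilon>: "0 < \<epsilon>"
  shows "finite {k\<in>N. \<epsilon> \<le> \<bar>u \<bullet> e k\<bar>}"
proof -
  have "card F \<le> nat \<lfloor>(norm u)\<^sup>2 / \<epsilon>\<^sup>2\<rfloor>"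
    if F: "F \<subseteq> {k\<in>N. \<epsilon> \<le> \<bar>u \<bullet> e k\<bar>}" "finite F" for F
  proof -
    have "real (card F) * \<epsilon>\<^sup>2 = (\<Sum>k\<in>F. \<epsilon>\<^sup>2)" by simp
    also have "\<dots> \<le> (\<Sum>k\<in>F. (u \<bullet> e k)\<^sup>2)"
    proof (rule sum_mono)
      fix k assume "k \<in> F"
      then have "\<bar>\<epsilon>\<bar> \<le> \<bar>u \<bullet> e k\<bar>" using F \<epsilon> by auto
      then show "\<epsilon>\<^sup>2 \<le> (u \<bullet> e k)\<^sup>2" by (simp add: abs_le_square_iff)
    qed
    also have "\<dots> \<le> (norm u)\<^sup>2"
      using F ortho by (intro Bessel_inequality) blast+
    finally show ?thesis
      using \<epsilon> by (simp add: le_nat_floor field_simps)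
  qed
  then show ?thesis
    using finite_if_finite_subsets_card_bdd by blast
qed

section \<open>The distance to the boundaries is positive\<close>

text \<open>By Bessel only finitely many coordinates \<open>W\<close> of \<open>u\<close> reach \<open>\<omega> / 2\<close>. The others stay at
  distance at least \<open>\<omega> / 2\<close> from the boundaries, which lie outside the open interval of radius \<open>\<omega>\<close>; the
  finitely many in \<open>W\<close> contribute a positive minimum. The boundaries are nonempty because no \<open>I k\<close>
  is empty or the whole line; this matters since \<open>infdist\<close> to the empty set is 0.\<close>

lemma rho_pos:
  assumes ortho: "\<And>i j. i \<in> N \<Longrightarrow> j \<in> N \<Longrightarrow> e i \<bullet> e j = (if i = j then 1 else 0)"
    and proper: "\<And>k. k \<in> N \<Longrightarrow> I k \<noteq> UNIV"
    and \<omega>: "0 < \<omega>" "\<And>k. k \<in> N \<Longrightarrow> {-\<omega>..\<omega>} \<subseteq> I k"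
  shows "0 < rho N e I u"
proof -
  have ne: "frontier (I k) \<noteq> {}" if "k \<in> N" for k
  proof -
    have "0 \<in> I k" using \<omega> that by (auto simp: subset_eq)
    then show ?thesis using proper[OF that] by (auto simp: frontier_eq_empty)
  qed
  define W where "W = {k\<in>N. \<omega> / 2 \<le> \<bar>u \<bullet> e k\<bar>}"
  have "finite W"
    unfolding W_def using \<omega> by (intro finite_large_coordinates ortho) auto
  define D where "D = (\<lambda>k. infdist (u \<bullet> e k) (frontier (I k))) `
    {k\<in>W. u \<bullet> e k \<in> interior (I k)}"
  have "finite D" using \<open>finite W\<close> by (simp add: D_def)
  have D_pos: "0 < d" if d: "d \<in> D" for d
  proof -
    obtain k where "k \<in> N" "u \<bullet> e k \<in> interior (I k)" "d = infdist (u \<bullet> e k) (frontier (I k))"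
      using d by (auto simp: D_def W_def)
    then show ?thesis
      using ne[of k] by (auto intro!: infdist_pos_not_in_closed simp: frontier_def)
  qed
  define r where "r = Min (insert (\<omega> / 2) D)"
  have "0 < r" using \<open>finite D\<close> D_pos \<omega> by (simp add: r_def)
  moreover have "ereal r \<le> rho N e I u"
    unfolding rho_def
  proof (rule INF_greatest)
    fix k assume k: "k \<in> {k\<in>N. u \<bullet> e k \<in> interior (I k)}"
    show "ereal r \<le> ereal (infdist (u \<bullet> e k) (frontier (I k)))"
    proof (cases "k \<in> W")
      case True
      then have "infdist (u \<bullet> e k) (frontier (I k)) \<in> D"
        using k by (auto simp: D_def)
      then show ?thesis using \<open>finite D\<close> by (simp add: r_def)
    next
      case False
      have "{-\<omega><..<\<omega>} \<subseteq> {-\<omega>..\<omega>}" by auto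
      then have sub: "{-\<omega><..<\<omega>} \<subseteq> interior (I k)"
        using k \<omega>(2)[of k] by (intro interior_maximal) auto
      have "\<omega> / 2 \<le> dist (u \<bullet> e k) z" if "z \<in> frontier (I k)" for z
      proof -
        have "\<not> (-\<omega> < z \<and> z < \<omega>)" using that sub by (auto simp: frontier_def)
        then show ?thesis using False k by (auto simp: W_def dist_real_def)
      qed
      then have "\<omega> / 2 \<le> (INF z\<in>frontier (I k). dist (u \<bullet> e k) z)"
        using k by (intro cINF_greatest ne) auto
      then have "\<omega> / 2 \<le> infdist (u \<bullet> e k) (frontier (I k))"
        using k by (simp add: infdist_notempty ne)
      moreover have "r \<le> \<omega> / 2"
        unfolding r_def using \<open>finite D\<close> by (intro Min_le) auto
      ultimately show ?thesis by simp
    qed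
  qed
  ultimately show ?thesis by (metis ereal_less(2) less_le_trans)
qed

section \<open>Quantitative decrease and the counting argument\<close>

text \<open>A budget argument: a nonnegative nonincreasing sequence that loses \<open>c\<close> on entering each
  index in \<open>A\<close> can do so at most \<open>a 0 / c\<close> times. Index 0 is excluded, having no predecessor.\<close>

lemma card_le_of_quantitative_decrease:
  fixes a :: "nat \<Rightarrow> real"
  assumes nn: "\<And>n. 0 \<le> a n" and c: "0 < c" and A: "0 \<notin> A"
    and mono: "\<And>n. a (Suc n) \<le> a n"
    and drop: "\<And>n. Suc n \<in> A \<Longrightarrow> a (Suc n) + c \<le> a n"
  shows "finite A" "c * real (card A) \<le> a 0"
proof -
  have total: "a n + c * real (card (A \<inter> {..n})) \<le> a 0" for n
  proof (induction n)
    case 0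
    then show ?case using A by (simp add: atMost_0)
  next
    case (Suc n)
    then show ?case
      using mono[of n] drop[of n]
      by (cases "Suc n \<in> A") (simp_all add: atMost_Suc Int_insert_right algebra_simps)
  qed
  have bound: "c * real (card F) \<le> a 0" if F: "F \<subseteq> A" "finite F" for F
  proof -
    have "F \<subseteq> A \<inter> {..Max (insert 0 F)}" using F by auto
    then have "card F \<le> card (A \<inter> {..Max (insert 0 F)})"
      by (intro card_mono) auto
    then have "c * real (card F) \<le> c * real (card (A \<inter> {..Max (insert 0 F)}))"
      using c by simp
    then show ?thesis using total[of "Max (insert 0 F)"] nn[of "Max (insert 0 F)"] by linarith
  qed
  have "card F \<le> nat \<lfloor>a 0 / c\<rfloor>" if "F \<subseteq> A" "finite F" for F
    using bound[OF that] c by (simp add: le_nat_floor field_simps)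
  then show "finite A"
    using finite_if_finite_subsets_card_bdd by blast
  then show "c * real (card A) \<le> a 0" by (intro bound) auto
qed

text \<open>Firm nonexpansiveness of the proximal step, with the term that is usually discarded
  expressed by the difference of the two subgradients.\<close>

lemma resolvent_quantitative_decrease:
  fixes p q u w :: "'a::real_inner"
  assumes p: "subgradient g p ((1 / lam) *\<^sub>R (u - p))" and q: "subgradient g q w"
    and lam: "0 < lam"
  shows "(norm (p - q))\<^sup>2 + (lam * norm ((1 / lam) *\<^sub>R (u - p) - w))\<^sup>2
    \<le> (norm (u - (q + lam *\<^sub>R w)))\<^sup>2"
proof -
  define r where "r = (1 / lam) *\<^sub>R (u - p) - w"
  have "0 \<le> lam * (r \<bullet> (p - q))"
    using subgradient_monotone[OF p q] lam by (simp add: r_def)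
  moreover have eq: "u - (q + lam *\<^sub>R w) = (p - q) + lam *\<^sub>R r"
    using lam by (simp add: r_def algebra_simps)
  moreover have "(norm ((p - q) + lam *\<^sub>R r))\<^sup>2
      = (norm (p - q))\<^sup>2 + 2 * (lam * (r \<bullet> (p - q))) + (lam * norm r)\<^sup>2"
    unfolding power_mult_distrib power2_norm_eq_inner
    by (simp add: inner_add_left inner_add_right inner_commute power2_eq_square)
  ultimately have "(norm (p - q))\<^sup>2 + (lam * norm r)\<^sup>2 \<le> (norm (u - (q + lam *\<^sub>R w)))\<^sup>2"
    unfolding eq by linarith
  then show ?thesis by (simp only: r_def)
qed

theorem theorem3p9:
  fixes N :: "nat set"
    and e :: "nat \<Rightarrow> 'a::{real_inner, polish_space}"
    and f g :: "'a \<Rightarrow> ereal"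
    and h :: "'a \<Rightarrow> real"
    and dh :: "'a \<Rightarrow> 'a"
    and L \<omega> lam :: real
    and \<psi> gs :: "nat \<Rightarrow> real \<Rightarrow> ereal"
    and I :: "nat \<Rightarrow> real set"
    and x :: "nat \<Rightarrow> 'a"
    and xbar xsol :: 'a
  assumes basis: "orthonormal_basis N e"
    and f_def: "f = (\<lambda>y. g y + ereal (h y))"
    and h_Gamma0: "(\<lambda>y. ereal (h y)) \<in> Gamma0"
    and h_bdd: "bdd_below (range h)"
    and h_grad: "\<And>y. GDERIV h y :> dh y"
    and L_pos: "0 < L"
    and dh_lipschitz: "L-lipschitz_on UNIV dh"
    and g_def: "g = separable_fun N e gs"
    and gs_def: "\<And>k t. k \<in> N \<Longrightarrow> gs k t = \<psi> k t + support_fun (I k) t"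
    and I_interval: "\<And>k. k \<in> N \<Longrightarrow> is_interval (I k)"
    and I_closed: "\<And>k. k \<in> N \<Longrightarrow> closed (I k)"
    and I_proper: "\<And>k. k \<in> N \<Longrightarrow> I k \<noteq> UNIV"
    and \<omega>_pos: "0 < \<omega>"
    and I_omega: "\<And>k. k \<in> N \<Longrightarrow> {-\<omega>..\<omega>} \<subseteq> I k"
    and \<psi>_Gamma0: "\<And>k. k \<in> N \<Longrightarrow> \<psi> k \<in> Gamma0"
    and \<psi>_zero: "\<And>k. k \<in> N \<Longrightarrow> \<psi> k 0 = 0"
    and \<psi>_deriv: "\<And>k. k \<in> N \<Longrightarrow> has_ext_derivative_at (\<psi> k) 0 0"
    and lam_range: "0 < lam" "lam < 2 / L"
    and x_step: "\<And>n. x (Suc n) = prox lam g (x n - lam *\<^sub>R dh (x n))"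
    and xbar: "xbar \<in> argmin f"
    and xsol: "xsol \<in> argmin f"
  shows "finite {n. n \<ge> 1 \<and> \<not> supp N e (x n) \<subseteq> esupp N e I dh xbar} \<and>
    ereal (real (card {n. n \<ge> 1 \<and> \<not> supp N e (x n) \<subseteq> esupp N e I dh xbar}))
      \<le> (inverse (rho N e I (- dh xsol)))\<^sup>2 * ereal ((inverse lam)\<^sup>2) * ereal ((norm (x 0 - xbar))\<^sup>2)"
proof -
  have ortho: "e i \<bullet> e j = (if i = j then 1 else 0)" if "i \<in> N" "j \<in> N" for i j
    using basis that by (simp add: orthonormal_basis_def)
  have h_conv: "convex_fun (\<lambda>y. ereal (h y))"
    using h_Gamma0 by (simp add: Gamma0_def)
  have zero_I: "0 \<in> I k" if "k \<in> N" for k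
    using I_omega[OF that] \<omega>_pos by (auto simp: subset_eq)
  have \<psi>: "convex_fun (\<psi> k)" "lsc_fun (\<psi> k)" "\<psi> k t \<noteq> -\<infinity>" if "k \<in> N" for k t
    using \<psi>_Gamma0[OF that] by (auto simp: Gamma0_def proper_fun_def)
  have \<psi>_nonneg: "0 \<le> \<psi> k t" if "k \<in> N" for k t
    by (rule convex_fun_flat_at_zero_nonneg) (use that \<psi> \<psi>_deriv \<psi>_zero in auto)
  have gs_eq: "gs k = (\<lambda>t. \<psi> k t + support_fun (I k) t)" if "k \<in> N" for k
    using gs_def[OF that] by auto
  have gs_nonneg: "0 \<le> gs k t" if "k \<in> N" for k t
    using that \<psi>_nonneg zero_I by (simp add: gs_eq support_fun_nonneg)
  have gs_zero: "gs k 0 = 0" if "k \<in> N" for k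
    using that zero_I[OF that] support_fun_zero[of "I k"] by (auto simp: gs_eq \<psi>_zero)
  have gs_conv: "convex_fun (gs k)" and gs_lsc: "lsc_fun (gs k)" if "k \<in> N" for k
    unfolding gs_eq[OF that] using that \<psi> \<psi>_nonneg zero_I
    by (auto intro!: convex_fun_add lsc_fun_add convex_fun_support_fun lsc_fun_support_fun
        support_fun_nonneg)
  have g_conv: "convex_fun g" and g_lsc: "lsc_fun g"
    unfolding g_def using gs_nonneg gs_conv gs_lsc by (auto intro!: separable_fun_convex_lsc)
  have g_nonneg: "0 \<le> g y" for y
    unfolding g_def using gs_nonneg by (rule separable_fun_nonneg)
  have g_zero: "g 0 = 0"
    unfolding g_def using gs_nonneg gs_zero by (intro separable_fun_zero) auto

  have sol_sub: "subgradient g q (- dh q)" if q: "q \<in> argmin f" for q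
  proof (rule minimizer_imp_subgradient[OF g_conv _ _ h_grad])
    have "g q + ereal (h q) \<le> g 0 + ereal (h 0)"
      using q by (simp add: argmin_def f_def)
    then show "\<bar>g q\<bar> \<noteq> \<infinity>"
      using g_nonneg[of q] by (auto simp: g_zero)
    show "g y \<noteq> -\<infinity>" for y using g_nonneg[of y] by auto
    show "g q + ereal (h q) \<le> g y + ereal (h y)" for y
      using q by (simp add: argmin_def f_def)
  qed
  \<comment> \<open>\<open>rho\<close> is evaluated at \<open>xsol\<close> but the extended support at \<open>xbar\<close>; they share
    one gradient, as monotonicity of the subdifferential makes the inner product of the differences
    nonpositive while cocoercivity bounds it below by a multiple of the squared gradient difference.\<close>
  have grad_const: "dh xsol = dh xbar"
  proof -
    have "0 \<le> (- dh xsol - - dh xbar) \<bullet> (xsol - xbar)"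
      by (intro subgradient_monotone[of g] sol_sub xsol xbar)
    then have "(dh xsol - dh xbar) \<bullet> (xsol - xbar) \<le> 0"
      by (simp add: inner_diff_left)
    then have "L * ((dh xsol - dh xbar) \<bullet> (xsol - xbar)) \<le> 0"
      using L_pos by (simp add: mult_le_0_iff)
    then have "(norm (dh xsol - dh xbar))\<^sup>2 \<le> 0"
      using gradient_cocoercive[OF h_conv h_grad L_pos dh_lipschitz, of xsol xbar] by linarith
    then show ?thesis by simp
  qed

  define w where "w = - dh xbar"
  define R where "R = rho N e I w"
  define A where "A = {n. n \<ge> 1 \<and> \<not> supp N e (x n) \<subseteq> esupp N e I dh xbar}"
  define v where "v n = (1 / lam) *\<^sub>R (x n - lam *\<^sub>R dh (x n) - x (Suc n))" for n
  have w_sub: "subgradient g xbar w" unfolding w_def by (rule sol_sub[OF xbar])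
  have v_sub: "subgradient g (x (Suc n)) (v n)" for n
    unfolding v_def x_step
    by (rule prox_subgradient[OF g_conv g_lsc g_nonneg _ lam_range(1), of 0]) (simp add: g_zero)
  have R_pos: "0 < R"
    unfolding R_def using ortho I_proper \<omega>_pos I_omega by (rule rho_pos)

  have decrease: "(norm (x (Suc n) - xbar))\<^sup>2 + (lam * norm (v n - w))\<^sup>2 \<le> (norm (x n - xbar))\<^sup>2" for n
  proof -
    have "(norm (x (Suc n) - xbar))\<^sup>2 + (lam * norm (v n - w))\<^sup>2
        \<le> (norm ((x n - lam *\<^sub>R dh (x n)) - (xbar + lam *\<^sub>R w)))\<^sup>2"
      unfolding v_def
      by (rule resolvent_quantitative_decrease[OF v_sub[unfolded v_def] w_sub lam_range(1)])
    also have "xbar + lam *\<^sub>R w = xbar - lam *\<^sub>R dh xbar" by (simp add: w_def)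
    also have "(norm ((x n - lam *\<^sub>R dh (x n)) - (xbar - lam *\<^sub>R dh xbar)))\<^sup>2 \<le> (norm (x n - xbar))\<^sup>2"
      by (intro power_mono norm_ge_zero
          gradient_step_nonexpansive[OF h_conv h_grad L_pos dh_lipschitz lam_range])
    finally show ?thesis .
  qed

  \<comment> \<open>One coordinate that is active in \<open>x (Suc n)\<close> but outside the extended support suffices.\<close>
  have gap: "R \<le> ereal (norm (v n - w))" if n: "Suc n \<in> A" for n
  proof -
    obtain k where k: "k \<in> N" and pk: "x (Suc n) \<bullet> e k \<noteq> 0" and qk: "xbar \<bullet> e k = 0"
        and bd: "w \<bullet> e k \<notin> frontier (I k)"
      using n by (auto simp: A_def supp_def esupp_def w_def)
    have "ereal ((w \<bullet> e k) * t) \<le> \<psi> k t + support_fun (I k) t" for t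
      unfolding gs_def[OF k, symmetric]
      by (rule separable_subgradient_coordinate(2)[OF gs_nonneg ortho w_sub[unfolded g_def] k
          gs_zero[OF k] qk])
    then have wI: "w \<bullet> e k \<in> I k"
      by (rule minorant_slope_mem[OF I_interval[OF k] I_closed[OF k] zero_I[OF k]
          \<psi>_deriv[OF k] \<psi>_zero[OF k]])
    then have w_int: "w \<bullet> e k \<in> interior (I k)"
      using bd closure_subset by (auto simp: frontier_def)
    have "support_fun (I k) (x (Suc n) \<bullet> e k) \<le> gs k (x (Suc n) \<bullet> e k)"
      unfolding gs_def[OF k]
      using add_right_mono[OF \<psi>_nonneg[OF k], where c = "support_fun (I k) (x (Suc n) \<bullet> e k)"]
      by simp
    also have "\<dots> \<le> ereal ((v n \<bullet> e k) * (x (Suc n) \<bullet> e k))"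
      by (rule separable_subgradient_coordinate(1)[OF gs_nonneg ortho v_sub[unfolded g_def] k
          gs_zero[OF k]])
    finally have "infdist (w \<bullet> e k) (frontier (I k)) \<le> \<bar>v n \<bullet> e k - w \<bullet> e k\<bar>"
      by (rule frontier_distance_le_slope_gap[OF wI pk])
    also have "\<dots> = \<bar>(v n - w) \<bullet> e k\<bar>" by (simp add: inner_diff_left)
    also have "\<dots> \<le> norm (v n - w)"
    proof -
      have "norm (e k) = 1" using ortho[OF k k] by (simp add: norm_eq_sqrt_inner)
      then show ?thesis using Cauchy_Schwarz_ineq2[of "v n - w" "e k"] by simp
    qed
    finally have dist_le: "ereal (infdist (w \<bullet> e k) (frontier (I k))) \<le> ereal (norm (v n - w))" by simp
    have "R \<le> ereal (infdist (w \<bullet> e k) (frontier (I k)))"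
      unfolding R_def rho_def using k w_int by (intro INF_lower) auto
    then show ?thesis using dist_le by (rule order_trans)
  qed

  have "finite A \<and> ereal (real (card A))
      \<le> (inverse R)\<^sup>2 * ereal ((inverse lam)\<^sup>2) * ereal ((norm (x 0 - xbar))\<^sup>2)"
  proof (cases "R = \<infinity>")
    case True
    \<comment> \<open>A single bad iteration would bound \<open>R\<close> by a real number.\<close>
    have "A = {}"
    proof (rule ccontr)
      assume "A \<noteq> {}"
      then obtain m where "m \<in> A" by blast
      then obtain n where "Suc n \<in> A" by (cases m) (auto simp: A_def)
      then show False using gap[of n] True by simp
    qed
    then show ?thesis by (simp add: True power2_eq_square zero_ereal_def[symmetric])
  next
    case False
    then obtain r where r: "R = ereal r" "0 < r" using R_pos by (cases R) auto
    define a where "a n = (norm (x n - xbar))\<^sup>2" for n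
    have mono: "a (Suc n) \<le> a n" for n
      unfolding a_def
      using decrease[of n] zero_le_power2[of "lam * norm (v n - w)"] by linarith
    have drop: "a (Suc n) + (lam * r)\<^sup>2 \<le> a n" if n: "Suc n \<in> A" for n
    proof -
      have "r \<le> norm (v n - w)" using gap[OF n] r by simp
      then have "(lam * r)\<^sup>2 \<le> (lam * norm (v n - w))\<^sup>2"
        using r lam_range by (intro power_mono mult_left_mono) auto
      then show ?thesis using decrease[of n] unfolding a_def by linarith
    qed
    have a_nonneg: "0 \<le> a n" for n by (simp add: a_def)
    have c_pos: "0 < (lam * r)\<^sup>2" using r lam_range by simp
    have "0 \<notin> A" by (simp add: A_def)
    note count = card_le_of_quantitative_decrease[where a = a and A = A, OF a_nonneg c_pos this mono drop]
    have "real (card A) \<le> (inverse r)\<^sup>2 * (inverse lam)\<^sup>2 * a 0"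
    proof -
      have "real (card A) \<le> a 0 / (lam * r)\<^sup>2"
        using count(2) c_pos by (simp only: pos_le_divide_eq mult.commute)
      then show ?thesis
        by (simp add: power_mult_distrib divide_inverse power_inverse mult.commute mult.left_commute)
    qed
    moreover have "inverse R = ereal (inverse r)" using r by simp
    ultimately show ?thesis
      using count(1) by (simp add: a_def power2_eq_square)
  qed
  then show ?thesis
    unfolding A_def R_def w_def grad_const .
qed

end
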